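(* Let $\delta\in(0,1)$ and let $g_\delta(\theta)=\sum_{j=0}^{\infty}q_j^{(\delta)}e^{\mathbf{i}(j-1)\theta}$. Then for all $\theta\in\mathbb{R}\setminus\{2k\pi\mid k\in\mathbb{Z}\}$: (i) $\operatorname{Re}(g_\delta(\theta))>0$; (ii) $\dfrac{|\operatorname{Im}(g_\delta(\theta))|}{\operatorname{Re}(g_\delta(\theta))}<\tan\left(\dfrac{\delta}{2}\pi\right)$.
   Context: $\mathbf{i}$ is the imaginary unit. For $\delta\in(0,1)$ set $s_0^{(\delta)}=(\tfrac12)^\delta$, $s_1^{(\delta)}=(\tfrac32)^\delta-2(\tfrac12)^\delta$, $s_k^{(\delta)}=(k+\tfrac12)^\delta-2(k-\tfrac12)^\delta+(k-\tfrac32)^\delta$ for $k\ge2$; $q_0^{(\delta)}=-s_0^{(\delta)}$ and $q_k^{(\delta)}=s_{k-1}^{(\delta)}-s_k^{(\delta)}$ for $k\ge1$. The function $g_\delta$ is the generating function of the Toeplitz matrices $\mathbf{T}_n^{\delta}\in\mathbb{R}^{n\times n}$ whose $(j,k)$ entry is $q_{j-k+1}^{(\delta)}$ if $j-k+1\ge0$ and $0$ otherwise. The series converges absolutely. *)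

theory Defs
  imports Complex_Main
begin

fun s_coeff :: "real \<Rightarrow> nat \<Rightarrow> real" where
  "s_coeff \<delta> 0 = (1/2) powr \<delta>"
| "s_coeff \<delta> (Suc 0) = (3/2) powr \<delta> - 2 * (1/2) powr \<delta>"
| "s_coeff \<delta> k = (real k + 1/2) powr \<delta> - 2 * (real k - 1/2) powr \<delta> + (real k - 3/2) powr \<delta>"

fun q_coeff :: "real \<Rightarrow> nat \<Rightarrow> real" where
  "q_coeff \<delta> 0 = - s_coeff \<delta> 0"
| "q_coeff \<delta> (Suc k) = s_coeff \<delta> k - s_coeff \<delta> (Suc k)"

text \<open>The generating function of the Toeplitz matrices with \<open>(j, k)\<close> entry
  \<open>q_coeff \<delta> (j - k + 1)\<close> (zero above the first superdiagonal). The exponent starts at \<open>-1\<close>,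
  so it is formed in the reals, not in \<open>nat\<close>. The series converges absolutely for
  \<open>0 < \<delta> < 1\<close>.\<close>

definition g_fun :: "real \<Rightarrow> real \<Rightarrow> complex" where
  "g_fun \<delta> \<theta> =
     (\<Sum>j. complex_of_real (q_coeff \<delta> j) * exp (\<i> * complex_of_real ((real j - 1) * \<theta>)))"

end

(* Scaling gives x powr delta = c * integral over a > 0 of (1 - exp (-x a)) a powr (-1-delta). Inserting
   x = 2 k + 1 and summing under the integral sign turns g_delta(theta), up to a positive factor, into
   the integral of h(a) a powr (-1-delta), where for sigma = sin (theta/2)
     Re h = 1 - sigma^2 cosh a / (sinh^2 a + sigma^2),
     Im h = sigma cos (theta/2) sinh a / (sinh^2 a + sigma^2).
   Choose beta in (0, pi/2] with sin beta = |sigma|, so that i beta is a pole nearest to the real axis.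
   Pointwise Re h is larger, and |Im h| not larger, than the respective part of the contribution
   (sin beta / beta) * (a^2 + i a beta) / (a^2 + beta^2) of that pole. By the reflection formula for the Beta
   integral, the integral of this contribution has argument exactly delta pi / 2. *)
theory Submission
  imports Defs "HOL-Analysis.Analysis"
begin

subsection \<open>Elementary inequalities\<close>

lemma sum_lessThan_4: "(\<Sum>m<4::nat. f m) = f 0 + f 1 + f 2 + (f 3::real)"
  and sum_lessThan_5: "(\<Sum>m<5::nat. f m) = f 0 + f 1 + f 2 + f 3 + (f 4::real)"
  by (simp_all add: eval_nat_numeral)

lemma sin_quintic_bounds:
  fixes x :: real
  assumes "0 \<le> x"
  shows "sin x \<le> x - x^3/6 + x^5/120" and "x - x^3/6 - x^5/120 \<le> sin x"
proof -
  have s: "(\<Sum>m<5. sin_coeff m * x ^ m) = x - x^3/6"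
    by (simp add: sum_lessThan_5 sin_coeff_def fact_numeral)
  have "inverse (fact 5) * \<bar>x\<bar>^5 = x^5/120"
    using assms by (simp add: fact_numeral inverse_eq_divide)
  then have "\<bar>sin x - (x - x^3/6)\<bar> \<le> x^5/120"
    using Maclaurin_sin_bound[of x 5] by (simp only: s)
  then show "sin x \<le> x - x^3/6 + x^5/120" and "x - x^3/6 - x^5/120 \<le> sin x"
    by linarith+
qed

lemma cos_le_quartic: "cos x \<le> 1 - x^2/2 + x^4/24" for x :: real
proof -
  obtain t where t: "cos x = (\<Sum>m<4. cos_coeff m * x ^ m) + (cos (t + 1/2 * real 4 * pi) / fact 4) * x ^ 4"
    using Maclaurin_cos_expansion[of x 4] by blast
  have s: "(\<Sum>m<4. cos_coeff m * x ^ m) = 1 - x^2/2"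
    by (simp add: sum_lessThan_4 cos_coeff_def fact_numeral)
  have "cos (t + 1/2 * real 4 * pi) / fact 4 * x^4 \<le> 1/24 * x^4"
    by (intro mult_right_mono) (simp_all add: fact_numeral)
  then show ?thesis using t s by simp
qed

text \<open>All terms of the power series are nonnegative, so a partial sum is a lower
  bound.\<close>

lemma cosh_ge_quartic: "1 + x^2/2 + x^4/24 \<le> cosh x" for x :: real
proof -
  let ?f = "\<lambda>n. if even n then x ^ n /\<^sub>R fact n else 0"
  have "sum ?f {..<5} \<le> suminf ?f"
    using cosh_converges[of x] by (intro sum_le_suminf) (auto simp: sums_iff zero_le_even_power)
  also have "\<dots> = cosh x"
    using cosh_converges[of x] by (simp add: sums_iff)
  finally have "sum ?f {..<5} \<le> cosh x" .
  moreover have "sum ?f {..<5} = 1 + x^2/2 + x^4/24" by (simp add: sum_lessThan_5 fact_numeral)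
  ultimately show ?thesis by simp
qed

lemma cosh_minus_one_le: "0 \<le> x \<Longrightarrow> cosh x - 1 \<le> x * sinh x" for x :: real
proof -
  assume "0 \<le> x"
  have "(\<lambda>x. x * sinh x - cosh x + 1) 0 \<le> (\<lambda>x. x * sinh x - cosh x + 1) x"
  proof (rule DERIV_nonneg_imp_nondecreasing[OF \<open>0 \<le> x\<close>])
    fix y :: real assume "0 \<le> y" "y \<le> x"
    then show "\<exists>z. ((\<lambda>x. x * sinh x - cosh x + 1) has_real_derivative z) (at y) \<and> 0 \<le> z"
      by (intro exI[of _ "y * cosh y"]) (auto intro!: derivative_eq_intros simp: algebra_simps)
  qed
  then show ?thesis by simp
qed

text \<open>The difference of the two sides vanishes at 0 and has a nonnegative derivative by
  \<open>cosh_minus_one_le\<close>.\<close>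

lemma sinh_minus_arg_le: "0 \<le> x \<Longrightarrow> sinh x - x \<le> x\<^sup>2 / 2 * sinh x" for x :: real
proof -
  assume "0 \<le> x"
  let ?f = "\<lambda>x. x\<^sup>2 / 2 * sinh x - sinh x + x"
  have "?f 0 \<le> ?f x"
  proof (rule DERIV_nonneg_imp_nondecreasing[OF \<open>0 \<le> x\<close>])
    fix y :: real assume "0 \<le> y" "y \<le> x"
    have "0 \<le> y\<^sup>2 / 2 * cosh y" by (intro mult_nonneg_nonneg) auto
    with cosh_minus_one_le[OF \<open>0 \<le> y\<close>]
    have "0 \<le> y * sinh y + y\<^sup>2 / 2 * cosh y - cosh y + 1" by linarith
    then show "\<exists>z. (?f has_real_derivative z) (at y) \<and> 0 \<le> z"
      by (intro exI[of _ "y * sinh y + y\<^sup>2 / 2 * cosh y - cosh y + 1"])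
         (auto intro!: derivative_eq_intros)
  qed
  then show ?thesis by simp
qed

lemma sinh_ge_arg: "0 \<le> x \<Longrightarrow> x \<le> sinh x" for x :: real
proof -
  assume "0 \<le> x"
  have "(\<lambda>x. sinh x - x) 0 \<le> (\<lambda>x. sinh x - x) x"
  proof (rule DERIV_nonneg_imp_nondecreasing[OF \<open>0 \<le> x\<close>])
    fix y :: real assume "0 \<le> y" "y \<le> x"
    show "\<exists>z. ((\<lambda>x. sinh x - x) has_real_derivative z) (at y) \<and> 0 \<le> z"
      by (intro exI[of _ "cosh y - 1"]) (auto intro!: derivative_eq_intros simp: cosh_real_ge_1)
  qed
  then show ?thesis by simp
qed

text \<open>A rational bound on which the polynomial estimates in \<open>Y\<close> below rest;
  \<open>pi\<^sup>2 / 4\<close> is about 2.467.\<close>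

lemma half_pi_square_le:
  assumes "0 < \<beta>" "\<beta> \<le> pi/2"
  shows "\<beta>\<^sup>2 \<le> 5/2"
proof -
  have "\<beta> \<le> 1.58" using assms pi_approx by simp
  then have "\<beta>\<^sup>2 \<le> 1.58\<^sup>2" using assms by (intro power_mono) auto
  then show ?thesis by (simp add: power2_eq_square)
qed

text \<open>The next two bounds compare the imaginary and the real part of the integrand of
  \<open>has_integral_g_fun\<close> with the contribution of its pole \<open>a = \<i> \<beta>\<close> nearest to the real axis.\<close>

lemma sinh_sin_imag_bound:
  fixes a \<beta> :: real
  assumes a: "0 < a" and \<beta>: "0 < \<beta>" "\<beta> \<le> pi/2"
  shows "sinh a * cos \<beta> * (a\<^sup>2 + \<beta>\<^sup>2) \<le> a * ((sinh a)\<^sup>2 + (sin \<beta>)\<^sup>2)"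
proof -
  define c Y s where "c = cos \<beta>" and "Y = \<beta>\<^sup>2" and "s = sinh a"
  have Y: "0 < Y" "Y \<le> 5/2" using half_pi_square_le[OF \<beta>] \<beta> by (auto simp: Y_def)
  have c0: "0 \<le> c" using \<beta> by (auto simp: c_def intro!: cos_ge_zero)
  have cle: "c \<le> 1 - Y/2 + Y\<^sup>2/24" using cos_le_quartic[of \<beta>] by (simp add: c_def Y_def flip: power_mult)
  have c1: "c * (1 + Y/2) \<le> 1"
  proof -
    have "c * (1 + Y/2) \<le> (1 - Y/2 + Y\<^sup>2/24) * (1 + Y/2)"
      using cle Y by (intro mult_right_mono) auto
    also have "\<dots> = 1 - Y\<^sup>2 * (10 - Y) / 48" by (simp add: field_simps power2_eq_square)
    also have "\<dots> \<le> 1" using Y by simp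
    finally show ?thesis .
  qed
  \<comment> \<open>The quintic lower bound for \<open>sin \<beta> / \<beta>\<close>, squared,
    exceeds the quartic upper bound for the cosine; the gap starts with \<open>Y/6\<close>.\<close>
  have sin2: "Y * c \<le> (sin \<beta>)\<^sup>2"
  proof -
    have l: "\<beta> * (1 - Y/6 - Y\<^sup>2/120) \<le> sin \<beta>"
      using sin_quintic_bounds(2)[of \<beta>] \<beta> by (simp add: Y_def algebra_simps power2_eq_square power3_eq_cube numeral_eq_Suc)
    have Y2: "Y\<^sup>2 \<le> 5/2 * Y" using Y by (simp add: power2_eq_square)
    have p: "0 \<le> 1 - Y/6 - Y\<^sup>2/120" using Y Y2 by linarith
    have "1 - Y/2 + Y\<^sup>2/24 \<le> (1 - Y/6 - Y\<^sup>2/120)\<^sup>2"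
    proof -
      have "(1 - Y/6 - Y\<^sup>2/120)\<^sup>2 - (1 - Y/2 + Y\<^sup>2/24) = Y/6 - 11/360 * Y\<^sup>2 + Y^3/360 + (Y^2/120)^2"
        by (simp add: field_simps power2_eq_square power3_eq_cube)
      moreover have "0 \<le> Y^3/360" "0 \<le> (Y^2/120)^2" using Y by auto
      ultimately show ?thesis using Y2 Y by linarith
    qed
    with cle have "Y * c \<le> Y * (1 - Y/6 - Y\<^sup>2/120)\<^sup>2" using Y by (intro mult_left_mono) auto
    also have "\<dots> = (\<beta> * (1 - Y/6 - Y\<^sup>2/120))\<^sup>2" by (simp add: Y_def power_mult_distrib)
    also have "\<dots> \<le> (sin \<beta>)\<^sup>2" using l p \<beta> by (intro power_mono) auto
    finally show ?thesis .
  qed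
  have s: "a \<le> s" "s - a \<le> a\<^sup>2/2 * s"
    using sinh_ge_arg[of a] sinh_minus_arg_le[of a] a by (auto simp: s_def)
  \<comment> \<open>Since \<open>a * s \<le> s\<^sup>2\<close> and
    \<open>Y * c \<le> (sin \<beta>)\<^sup>2\<close>, it suffices that
    \<open>Y * c * (s - a) \<le> (1 - c) * (a\<^sup>2 * s)\<close>. The bound on
    \<open>s - a\<close> reduces this to \<open>c * Y/2 \<le> 1 - c\<close>, which is
    \<open>c1\<close>.\<close>
  have "Y * c * (s - a) \<le> Y * c * (a\<^sup>2/2 * s)"
    using s Y c0 by (intro mult_left_mono) auto
  also have "\<dots> = (c * (1 + Y/2) - c) * (a\<^sup>2 * s)" by (simp add: field_simps)
  also have "\<dots> \<le> (1 - c) * (a\<^sup>2 * s)" using c1 s a by (intro mult_right_mono) auto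
  finally have 1: "Y * c * s + c * a\<^sup>2 * s \<le> a\<^sup>2 * s + Y * c * a" by (simp add: algebra_simps)
  have "a\<^sup>2 * s + Y * c * a \<le> a * s\<^sup>2 + (sin \<beta>)\<^sup>2 * a"
    using s a sin2 by (intro add_mono mult_right_mono) (auto simp: power2_eq_square)
  with 1 show ?thesis by (simp add: c_def Y_def s_def algebra_simps)
qed

lemma sinh_sin_real_bound:
  fixes a \<beta> :: real
  assumes a: "0 < a" and \<beta>: "0 < \<beta>" "\<beta> \<le> pi/2"
  shows "sin \<beta> * a\<^sup>2 * ((sinh a)\<^sup>2 + (sin \<beta>)\<^sup>2)
    < \<beta> * (a\<^sup>2 + \<beta>\<^sup>2) * ((sinh a)\<^sup>2 + (sin \<beta>)\<^sup>2 - (sin \<beta>)\<^sup>2 * cosh a)"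
proof -
  \<comment> \<open>\<open>\<kappa>\<close> and \<open>p\<close> are the difference quotients that
    let \<open>X\<close> and \<open>Y\<close> factor out of the difference of the two sides; as
    \<open>a\<close> and \<open>\<beta>\<close> tend to 0 they tend to 1/2 and 1/6.\<close>
  define X Y \<tau> p \<kappa> where "X = a\<^sup>2" and "Y = \<beta>\<^sup>2" and "\<tau> = sin \<beta> / \<beta>"
    and "p = (1 - \<tau>) / Y" and "\<kappa> = (cosh a - 1) / X"
  have X: "0 < X" using a by (simp add: X_def)
  have Y: "0 < Y" "Y \<le> 5/2" using half_pi_square_le[OF \<beta>] \<beta> by (auto simp: Y_def)
  have sin: "sin \<beta> = \<tau> * \<beta>" using \<beta> by (simp add: \<tau>_def)
  have \<tau>p: "\<tau> = 1 - p * Y" using Y by (simp add: p_def)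
  have cosh: "cosh a = 1 + \<kappa> * X" using X by (simp add: \<kappa>_def)
  have sinh: "(sinh a)\<^sup>2 = \<kappa> * X * (2 + \<kappa> * X)"
    using cosh_square_eq[of a] by (simp add: cosh algebra_simps power2_eq_square)
  define L where "L = 1 - Y/6 + Y\<^sup>2/120"
  have "\<tau> > 0" using \<beta> by (auto simp: \<tau>_def intro!: divide_pos_pos sin_gt_zero)
  have "\<tau> \<le> 1" using sin_x_le_x[of \<beta>] \<beta> by (simp add: \<tau>_def)
  have \<tau>L: "\<tau> \<le> L" using sin_quintic_bounds(1)[of \<beta>] \<beta>
    by (simp add: \<tau>_def L_def Y_def field_simps power2_eq_square power3_eq_cube numeral_eq_Suc)
  then have pl: "1/6 - Y/120 \<le> p"
    using Y by (simp add: p_def L_def field_simps power2_eq_square)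
  then have p0: "0 < p" using Y by linarith
  have Y2: "Y\<^sup>2 \<le> 5/2 * Y" using Y by (simp add: power2_eq_square)
  have L2: "L\<^sup>2 \<le> 1 - Y/3 + 2*Y\<^sup>2/45"
  proof -
    have "1 - Y/3 + 2*Y\<^sup>2/45 - L\<^sup>2 = Y^3 * (40 - Y) / 14400"
      by (simp add: L_def field_simps power2_eq_square power3_eq_cube)
    moreover have "0 \<le> Y^3 * (40 - Y) / 14400" using Y by simp
    ultimately show ?thesis by linarith
  qed
  have \<tau>2: "\<tau>\<^sup>2 \<le> 1 - Y/3 + 2*Y\<^sup>2/45"
    using L2 power_mono[OF \<tau>L, of 2] \<open>\<tau> > 0\<close> by linarith
  have \<tau>21: "\<tau>\<^sup>2 \<le> 1" using \<open>\<tau> \<le> 1\<close> \<open>\<tau> > 0\<close> by (simp add: power_le_one)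
  \<comment> \<open>This is the coefficient of \<open>X^0\<close> in \<open>G k\<close> below. Its
    terms of order 0 and 1 in \<open>Y\<close> cancel, so the bounds on \<open>\<tau>\<close> must
    be correct to second order.\<close>
  have c0: "0 < 1 - Y * \<tau>\<^sup>2 / 2 - \<tau>^3"
  proof -
    have "Y * \<tau>\<^sup>2 / 2 + \<tau>^3 = \<tau>\<^sup>2 * (Y/2 + \<tau>)" by (simp add: algebra_simps power2_eq_square power3_eq_cube)
    also have "\<dots> \<le> (1 - Y/3 + 2*Y\<^sup>2/45) * (Y/2 + L)"
      using \<tau>2 \<tau>L Y \<open>\<tau> > 0\<close> Y2 by (intro mult_mono) auto
    also have "\<dots> = 1 - Y\<^sup>2 * (315 - 65 * Y - 2 * Y\<^sup>2) / 5400"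
      by (simp add: L_def field_simps power2_eq_square)
    also have "\<dots> < 1" using Y Y2 by simp
    finally show ?thesis by linarith
  qed
  \<comment> \<open>This is the coefficient of \<open>X\<close> in \<open>G k\<close>.\<close>
  have c1: "0 \<le> 1/3 + p - \<tau>\<^sup>2/2 - Y * \<tau>\<^sup>2/24"
  proof -
    have "\<tau>\<^sup>2 * (1/2 + Y/24) \<le> (1 - Y/3 + 2*Y\<^sup>2/45) * (1/2 + Y/24)"
      using \<tau>2 Y by (intro mult_right_mono) auto
    also have "\<dots> = 1/2 - Y/8 + Y\<^sup>2/120 + Y\<^sup>2 * Y/540"
      by (simp add: field_simps power2_eq_square)
    also have "\<dots> \<le> 1/2 - Y/8 + Y\<^sup>2/120 + Y\<^sup>2 * (5/2)/540"
      using Y by (intro add_left_mono divide_right_mono mult_left_mono) auto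
    finally show ?thesis using pl Y Y2 by (simp add: algebra_simps)
  qed
  define k where "k = 1/2 + X/24"
  have k: "k \<le> \<kappa>" using cosh_ge_quartic[of a] X
    by (simp add: k_def \<kappa>_def X_def field_simps flip: power_mult power_add)
  have k0: "0 < k" using X by (simp add: k_def)
  \<comment> \<open>\<open>X * Y * \<beta> * G \<kappa>\<close> is the difference of the two sides. \<open>G\<close> increases on \<open>[1/2, \<infinity>)\<close>, so
    \<open>\<kappa>\<close> may be replaced by its Taylor minorant \<open>k\<close>; then all coefficients in \<open>X\<close> are nonnegative.\<close>
  define G where "G = (\<lambda>u. u\<^sup>2 * X * (1 + p*X) + u * (2 - Y * \<tau>\<^sup>2 + X * (2*p - \<tau>\<^sup>2)) - \<tau>^3)"
  have "G k = (1 - Y * \<tau>\<^sup>2 / 2 - \<tau>^3) + X * (1/3 + p - \<tau>\<^sup>2/2 - Y * \<tau>\<^sup>2/24)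
      + X\<^sup>2 * (p/3 + (1 - \<tau>\<^sup>2)/24) + X^3 * (24*p + 1)/576 + X^4 * p/576"
    unfolding G_def k_def
    by (simp add: algebra_simps power2_eq_square power3_eq_cube power4_eq_xxxx
        add_divide_distrib diff_divide_distrib)
  moreover have "0 \<le> X\<^sup>2 * (p/3 + (1 - \<tau>\<^sup>2)/24)" "0 \<le> X^3 * (24*p + 1)/576" "0 \<le> X^4 * p/576"
    "0 \<le> X * (1/3 + p - \<tau>\<^sup>2/2 - Y * \<tau>\<^sup>2/24)"
    using X p0 \<tau>21 c1 by auto
  ultimately have "0 < G k" using c0 by linarith
  also have "G k \<le> G \<kappa>"
  proof -
    have "G \<kappa> - G k = (\<kappa> - k) * ((\<kappa> + k) * X * (1 + p*X) + (2 - Y * \<tau>\<^sup>2) + X * (2*p - \<tau>\<^sup>2))"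
      by (simp add: G_def algebra_simps power2_eq_square)
    \<comment> \<open>As \<open>\<kappa> + k \<ge> 1\<close>, the first summand is at least
      \<open>X\<close> and outweighs the possibly negative
      \<open>X * (2*p - \<tau>\<^sup>2)\<close>.\<close>
    moreover have "0 \<le> (\<kappa> + k) * X * (1 + p*X) + (2 - Y * \<tau>\<^sup>2) + X * (2*p - \<tau>\<^sup>2)"
    proof -
      have "1 * X * 1 \<le> (\<kappa> + k) * X * (1 + p*X)"
        using k k0 X p0 by (intro mult_mono) (auto simp: k_def)
      moreover have "Y * \<tau>\<^sup>2 = (sin \<beta>)\<^sup>2" by (simp add: sin Y_def power_mult_distrib)
      moreover have "(sin \<beta>)\<^sup>2 \<le> 1" by (simp add: abs_square_le_1)
      moreover have "X * (- 1) \<le> X * (2*p - \<tau>\<^sup>2)" using X p0 \<tau>21 by (intro mult_left_mono) auto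
      ultimately show ?thesis by linarith
    qed
    ultimately have "0 \<le> G \<kappa> - G k" using k by (metis diff_ge_0_iff_ge mult_nonneg_nonneg)
    then show ?thesis by linarith
  qed
  finally have "0 < G \<kappa> * (X * Y * \<beta>)" using X Y \<beta> by simp
  also have "G \<kappa> * (X * Y * \<beta>) = \<beta> * (X + Y) * ((sinh a)\<^sup>2 + (sin \<beta>)\<^sup>2 - (sin \<beta>)\<^sup>2 * cosh a)
      - sin \<beta> * X * ((sinh a)\<^sup>2 + (sin \<beta>)\<^sup>2)"
  proof -
    have "\<beta>\<^sup>2 = Y" by (simp add: Y_def)
    with \<tau>p show ?thesis unfolding sinh cosh sin power_mult_distrib G_def \<open>\<beta>\<^sup>2 = Y\<close> by algebra
  qed
  finally show ?thesis by (simp add: X_def Y_def)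
qed

subsection \<open>The integral of the pole term\<close>

text \<open>Euler's reflection formula, carried over from the complex Gamma function; the
  denominator of the Beta function is \<open>Gamma 1 = 1\<close>.\<close>

lemma Beta_one_minus_real:
  fixes p :: real
  assumes "0 < p" "p < 1"
  shows "Beta p (1 - p) = pi / sin (pi * p)"
proof -
  have "complex_of_real (Gamma p * Gamma (1 - p)) = of_real (pi / sin (pi * p))"
    using Gamma_reflection_complex[of "of_real p"] Gamma_complex_of_real[of p]
      Gamma_complex_of_real[of "1 - p"] sin_of_real[of "pi * p", where 'a = complex]
    by simp
  then have "Gamma p * Gamma (1 - p) = pi / sin (pi * p)"
    by (simp only: of_real_eq_iff)
  then show ?thesis by (simp add: Beta_def)
qed

text \<open>The substitution \<open>u = a\<^sup>2 / (a\<^sup>2 + \<beta>\<^sup>2)\<close>, with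
  inverse \<open>g\<close>, maps the half-line onto the unit interval and produces a Beta integral
  with parameters \<open>p = (1 + s) / 2\<close> and \<open>1 - p\<close>.\<close>

lemma has_integral_powr_div_sum_squares:
  fixes s \<beta> :: real
  assumes s: "-1 < s" "s < 1" and \<beta>: "0 < \<beta>"
  shows "((\<lambda>a. a powr s / (a\<^sup>2 + \<beta>\<^sup>2)) has_integral
    \<beta> powr (s - 1) * (pi / (2 * sin (pi * ((1 + s) / 2))))) {0<..}"
proof -
  define S :: "real set" where "S = {0<..<1}"
  define g where "g = (\<lambda>u. \<beta> * sqrt (u / (1 - u)))"
  define g' where "g' = (\<lambda>u. \<beta> * (inverse (sqrt (u / (1 - u))) / 2 * (1 / (1 - u)\<^sup>2)))"
  define f where "f = (\<lambda>a. a powr s / (a\<^sup>2 + \<beta>\<^sup>2))"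
  define p where "p = (1 + s) / 2"
  have p: "0 < p" "p < 1" using s by (auto simp: p_def)
  have deriv: "(g has_field_derivative g' u) (at u within S)" if "u \<in> S" for u
  proof -
    have u: "0 < u" "u < 1" using that by (auto simp: S_def)
    have "((\<lambda>u. u / (1 - u)) has_field_derivative 1 / (1 - u)\<^sup>2) (at u)"
      using u by (auto intro!: derivative_eq_intros simp: field_simps power2_eq_square)
    moreover have "0 < u / (1 - u)" using u by simp
    ultimately have "((\<lambda>u. sqrt (u / (1 - u))) has_field_derivative
        inverse (sqrt (u / (1 - u))) / 2 * (1 / (1 - u)\<^sup>2)) (at u)"
      by (rule DERIV_chain2[OF DERIV_real_sqrt, rotated])
    then show ?thesis
      unfolding g_def g'_def by (rule DERIV_cmult[OF has_field_derivative_at_within])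
  qed
  have inj: "inj_on g S"
  proof (rule inj_onI)
    fix x y assume xy: "x \<in> S" "y \<in> S" "g x = g y"
    then have "x / (1 - x) = y / (1 - y)" using \<beta> by (simp add: g_def del: real_sqrt_divide)
    then show "x = y" using xy by (simp add: S_def field_simps)
  qed
  have img: "g ` S = {0<..}"
  proof (intro equalityI subsetI)
    fix a :: real assume a: "a \<in> {0<..}"
    define u where "u = a\<^sup>2 / (a\<^sup>2 + \<beta>\<^sup>2)"
    have pos: "0 < a\<^sup>2 + \<beta>\<^sup>2" using \<beta> by (simp add: add_nonneg_pos)
    have "1 - u = \<beta>\<^sup>2 / (a\<^sup>2 + \<beta>\<^sup>2)" 
      using \<beta> pos by (simp add: u_def eq_divide_eq left_diff_distrib)
    then have "u / (1 - u) = (a / \<beta>)\<^sup>2"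
      using \<beta> pos by (simp add: u_def power_divide)
    then have "g u = a" using a \<beta> by (simp add: g_def)
    moreover have "u \<in> S" using a \<beta> pos by (simp add: S_def u_def)
    ultimately show "a \<in> g ` S" by blast
  qed (use \<beta> in \<open>auto simp: g_def S_def\<close>)
  have "\<bar>g' u\<bar> * f (g u) = 1/2 * \<beta> powr (s - 1) * (u powr (p - 1) * (1 - u) powr ((1 - p) - 1))"
    if "u \<in> S" for u
  proof -
    have u: "0 < u" "u < 1" using that by (auto simp: S_def)
    define v where "v = u / (1 - u)"
    have v: "0 < v" using u by (simp add: v_def)
    have "(g u)\<^sup>2 + \<beta>\<^sup>2 = \<beta>\<^sup>2 * (v + 1)"
      using v by (simp add: g_def v_def[symmetric] power_mult_distrib algebra_simps)
    also have "v + 1 = 1 / (1 - u)" using u by (simp add: v_def field_simps)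
    finally have d: "(g u)\<^sup>2 + \<beta>\<^sup>2 = \<beta>\<^sup>2 / (1 - u)" by simp
    have sqrt: "sqrt v = v powr (1/2)" using v by (simp add: powr_half_sqrt)
    have n: "g u powr s = \<beta> powr s * v powr (s/2)"
      unfolding g_def v_def[symmetric] sqrt using v \<beta> by (simp add: powr_mult powr_powr)
    have "\<bar>g' u\<bar> = \<beta> * (v powr (-(1/2)) / (2 * (1 - u)\<^sup>2))"
      unfolding g'_def v_def[symmetric] sqrt powr_minus using \<beta> u v by (simp add: abs_mult)
    \<comment> \<open>The cancellation is stated for arbitrary reals so that the real powers remain
      atomic.\<close>
    moreover have "\<beta> * (V / (2 * w\<^sup>2)) * (B * N / (\<beta>\<^sup>2 / w)) = 1/2 * (B / \<beta>) * (N * V) / w"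
      if "w \<noteq> 0" for V B N w :: real
      using that \<beta> by (simp add: power2_eq_square mult_ac)
    ultimately have "\<bar>g' u\<bar> * f (g u) = 1/2 * (\<beta> powr s / \<beta>) * (v powr (s/2) * v powr (-(1/2))) / (1 - u)"
      using u unfolding f_def d n by simp
    also have "v powr (s/2) * v powr (-(1/2)) = v powr (p - 1)"
      using powr_add[of v "s/2" "-(1/2)"] by (simp add: p_def add_divide_distrib)
    also have "v powr (p - 1) = u powr (p - 1) * (1 - u) powr (1 - p)"
      using u powr_minus[of "1 - u" "p - 1"] powr_divide[of u "1 - u" "p - 1"]
      by (simp add: v_def) (simp add: divide_inverse)
    also have "(1 - u) powr (1 - p) = (1 - u) powr ((1 - p) - 1) * (1 - u)"
      using u by (simp add: powr_diff powr_minus_divide)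
    finally show ?thesis using \<beta> u by (simp add: powr_diff)
  qed
  note eq = this
  have "((\<lambda>u. 1/2 * \<beta> powr (s - 1) * (u powr (p - 1) * (1 - u) powr ((1 - p) - 1))) has_integral
     1/2 * \<beta> powr (s - 1) * Beta p (1 - p)) S"
    using has_integral_Beta_real[of p "1 - p"] p
    by (intro has_integral_mult_right) (simp add: has_integral_Icc_iff_Ioo S_def)
  then have I: "((\<lambda>u. \<bar>g' u\<bar> * f (g u)) has_integral 1/2 * \<beta> powr (s - 1) * Beta p (1 - p)) S"
    by (rule has_integral_eq[rotated]) (simp add: eq)
  have "(\<lambda>u. \<bar>g' u\<bar> * f (g u)) absolutely_integrable_on S"
    using I by (intro nonnegative_absolutely_integrable_1) (auto simp: f_def has_integral_iff)
  with I have "f absolutely_integrable_on g ` S \<and> integral (g ` S) f = 1/2 * \<beta> powr (s - 1) * Beta p (1 - p)"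
    using has_absolute_integral_change_of_variables_1'[OF _ deriv inj, of f "1/2 * \<beta> powr (s - 1) * Beta p (1 - p)"]
    by (simp add: S_def has_integral_iff)
  then have "(f has_integral 1/2 * \<beta> powr (s - 1) * Beta p (1 - p)) {0<..}"
    by (simp add: has_integral_iff set_lebesgue_integral_eq_integral img)
  then show ?thesis using p by (simp add: Beta_one_minus_real f_def p_def mult_ac)
qed

text \<open>The pole term lies exactly on the boundary of the sector of half-angle \<open>\<delta> / 2 * pi\<close>.\<close>

lemma has_integral_pole_balance:
  fixes \<delta> \<beta> :: real
  assumes "0 < \<delta>" "\<delta> < 1" "0 < \<beta>"
  shows "((\<lambda>a. (sin (\<delta> / 2 * pi) * a - cos (\<delta> / 2 * pi) * \<beta>) * a powr (-\<delta>) / (a\<^sup>2 + \<beta>\<^sup>2))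
    has_integral 0) {0<..}"
proof -
  let ?\<phi> = "\<delta> / 2 * pi"
  have pos: "sin ?\<phi> > 0" "cos ?\<phi> > 0"
    using assms mult_strict_right_mono[of \<delta> 1 pi] by (auto intro!: sin_gt_zero cos_gt_zero)
  \<comment> \<open>The exponents \<open>1 - \<delta>\<close> and \<open>- \<delta>\<close> give the
    sine and the cosine of the same angle. They cancel against the weights, and both terms become
    \<open>\<beta> powr (- \<delta>) * pi / 2\<close>.\<close>
  have s1: "sin (pi * ((1 + (1 - \<delta>)) / 2)) = sin ?\<phi>"
    using sin_pi_minus[of ?\<phi>] by (simp add: field_simps)
  have s2: "sin (pi * ((1 + - \<delta>) / 2)) = cos ?\<phi>"
    using sin_cos_eq[of "pi * ((1 + - \<delta>) / 2)"] by (simp add: field_simps)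
  have "((\<lambda>a. sin ?\<phi> * (a powr (1 - \<delta>) / (a\<^sup>2 + \<beta>\<^sup>2)) - cos ?\<phi> * \<beta> * (a powr (- \<delta>) / (a\<^sup>2 + \<beta>\<^sup>2)))
    has_integral sin ?\<phi> * (\<beta> powr ((1 - \<delta>) - 1) * (pi / (2 * sin ?\<phi>)))
      - cos ?\<phi> * \<beta> * (\<beta> powr (- \<delta> - 1) * (pi / (2 * cos ?\<phi>)))) {0<..}"
    using has_integral_powr_div_sum_squares[of "1 - \<delta>" \<beta>] has_integral_powr_div_sum_squares[of "- \<delta>" \<beta>]
      assms unfolding s1 s2 by (intro has_integral_diff has_integral_mult_right) auto
  also have "sin ?\<phi> * (\<beta> powr ((1 - \<delta>) - 1) * (pi / (2 * sin ?\<phi>)))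
      - cos ?\<phi> * \<beta> * (\<beta> powr (- \<delta> - 1) * (pi / (2 * cos ?\<phi>))) = 0"
    using pos assms by (simp add: powr_diff)
  finally show ?thesis
  proof (rule has_integral_eq[rotated])
    fix a :: real assume "a \<in> {0<..}"
    then have "a powr (1 - \<delta>) = a * a powr (- \<delta>)" by (simp add: powr_diff powr_minus_divide)
    then show "sin ?\<phi> * (a powr (1 - \<delta>) / (a\<^sup>2 + \<beta>\<^sup>2)) - cos ?\<phi> * \<beta> * (a powr (- \<delta>) / (a\<^sup>2 + \<beta>\<^sup>2))
      = (sin ?\<phi> * a - cos ?\<phi> * \<beta>) * a powr (-\<delta>) / (a\<^sup>2 + \<beta>\<^sup>2)"
      by (simp add: left_diff_distrib diff_divide_distrib)
  qed
qed

subsection \<open>Summing the exponential kernel\<close>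

lemma geometric_sum_le_one:
  fixes x :: real
  assumes "0 \<le> x" "x \<le> 1"
  shows "(1 - x) * (\<Sum>k<n. x ^ k) \<le> 1"
proof -
  have "(1 - x) * (\<Sum>k<n. x ^ k) = 1 - x ^ n" by (simp add: one_diff_power_eq)
  then show ?thesis using assms by simp
qed

text \<open>The coefficients with \<open>(k + 1/2) powr \<delta>\<close> replaced by \<open>1 - r ^ (2 * k + 1)\<close>. At \<open>r = exp (-a)\<close> they
  integrate to multiples of \<^const>\<open>s_coeff\<close> and \<^const>\<open>q_coeff\<close>.\<close>

fun s_kernel :: "real \<Rightarrow> nat \<Rightarrow> real" where
  "s_kernel r 0 = 1 - r"
| "s_kernel r (Suc 0) = (1 - r ^ 3) - 2 * (1 - r)"
| "s_kernel r (Suc (Suc k)) = (1 - r ^ (2 * k + 5)) - 2 * (1 - r ^ (2 * k + 3)) + (1 - r ^ (2 * k + 1))"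

fun q_kernel :: "real \<Rightarrow> nat \<Rightarrow> real" where
  "q_kernel r 0 = - s_kernel r 0"
| "q_kernel r (Suc k) = s_kernel r k - s_kernel r (Suc k)"

text \<open>A second difference of the geometric sequence \<open>r ^ (2 * k + 1)\<close> is again
  geometric, so the tail has constant sign and ratio \<open>r\<^sup>2\<close>.\<close>

lemma s_kernel_add_2: "s_kernel r (Suc (Suc k)) = - (r * (1 - r\<^sup>2)\<^sup>2 * (r\<^sup>2) ^ k)"
  by (simp add: power_add power_mult algebra_simps power2_eq_square eval_nat_numeral)

text \<open>The first two terms and the geometric tail contribute 1, 5 and 2 times
  \<open>1 - r\<close>. The factor \<open>1 - r\<close> matters: at \<open>r = exp (-a)\<close> it
  compensates the singularity of \<open>a powr (-1-\<delta>)\<close> at 0.\<close>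

lemma sum_abs_s_kernel_le:
  assumes "0 \<le> r" "r \<le> 1"
  shows "(\<Sum>k<n. \<bar>s_kernel r k\<bar>) \<le> 8 * (1 - r)"
proof -
  have r2: "r\<^sup>2 \<le> 1" using assms by (simp add: power_le_one)
  have "(\<Sum>k<n. \<bar>s_kernel r k\<bar>) \<le> (\<Sum>k<Suc (Suc n). \<bar>s_kernel r k\<bar>)"
    by (intro sum_mono2) auto
  also have "\<dots> = \<bar>1 - r\<bar> + (\<bar>(1 - r ^ 3) - 2 * (1 - r)\<bar> + (\<Sum>k<n. \<bar>s_kernel r (Suc (Suc k))\<bar>))"
    by (simp only: sum.lessThan_Suc_shift s_kernel.simps(1,2))
  also have "(\<Sum>k<n. \<bar>s_kernel r (Suc (Suc k))\<bar>) = r * (1 - r\<^sup>2) * ((1 - r\<^sup>2) * (\<Sum>k<n. (r\<^sup>2) ^ k))"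
    unfolding s_kernel_add_2 using assms
    by (simp add: abs_mult sum_distrib_left power2_eq_square mult_ac)
  also have "\<dots> \<le> r * (1 - r\<^sup>2) * 1"
    using geometric_sum_le_one[of "r\<^sup>2" n] assms r2 by (intro mult_left_mono) auto
  also have "\<dots> \<le> 1 * (1 - r\<^sup>2) * 1"
    using assms r2 by (intro mult_right_mono) auto
  also have "1 * (1 - r\<^sup>2) * 1 = (1 - r) * (1 + r)" by (simp add: algebra_simps power2_eq_square)
  also have "\<dots> \<le> (1 - r) * 2" using assms by (intro mult_left_mono) auto
  also have "\<bar>(1 - r ^ 3) - 2 * (1 - r)\<bar> \<le> 5 * (1 - r)"
  proof -
    have "1 - r ^ 3 = (1 - r) * (1 + r + r\<^sup>2)" by (simp add: algebra_simps power2_eq_square power3_eq_cube)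
    also have "\<dots> \<le> (1 - r) * 3" using assms r2 by (intro mult_left_mono) auto
    finally have "1 - r ^ 3 \<le> 3 * (1 - r)" by simp
    moreover have "0 \<le> 1 - r ^ 3" using assms by (simp add: power_le_one)
    ultimately show ?thesis using assms by linarith
  qed
  finally show ?thesis using assms by simp
qed

text \<open>Summation by parts: \<open>q_kernel\<close> is the backward difference of
  \<open>s_kernel\<close> with reversed sign, which yields the factor \<open>z - 1\<close> and a
  boundary term.\<close>

lemma sum_q_kernel:
  fixes z :: complex
  shows "(\<Sum>j<Suc n. of_real (q_kernel r j) * z ^ j)
    = (z - 1) * (\<Sum>k<n. of_real (s_kernel r k) * z ^ k) - of_real (s_kernel r n) * z ^ n"
proof (induction n)
  case (Suc n)
  show ?case by (subst sum.lessThan_Suc, subst Suc) (simp add: algebra_simps)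
qed simp

text \<open>This supplies the dominating function for the partial sums. On the unit circle
  \<open>norm (z - 1) \<le> 2\<close>, and the boundary term only extends the sum of the
  \<open>\<bar>s_kernel r k\<bar>\<close> by one term.\<close>

lemma norm_sum_q_kernel_le:
  fixes z :: complex
  assumes r: "0 \<le> r" "r \<le> 1" and z: "norm z = 1"
  shows "norm (\<Sum>j<n. of_real (q_kernel r j) * z ^ j) \<le> 16 * (1 - r)"
proof (cases n)
  case (Suc m)
  have 1: "norm (of_real (s_kernel r k) * z ^ k) = \<bar>s_kernel r k\<bar>" for k
    using z by (simp add: norm_mult norm_power)
  have "norm (\<Sum>j<n. of_real (q_kernel r j) * z ^ j)
      \<le> norm (z - 1) * norm (\<Sum>k<m. of_real (s_kernel r k) * z ^ k) + \<bar>s_kernel r m\<bar>"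
    unfolding Suc sum_q_kernel using norm_triangle_ineq4 by (metis 1 norm_mult)
  also have "\<dots> \<le> 2 * (\<Sum>k<m. \<bar>s_kernel r k\<bar>) + \<bar>s_kernel r m\<bar>"
    using norm_triangle_ineq4[of z 1] z sum_norm_le[of "{..<m}" "\<lambda>k. of_real (s_kernel r k) * z ^ k" "\<lambda>k. \<bar>s_kernel r k\<bar>"]
    by (intro add_mono mult_mono) (auto simp: 1)
  also have "\<dots> \<le> 2 * (\<Sum>k<Suc m. \<bar>s_kernel r k\<bar>)" by simp
  also have "\<dots> \<le> 16 * (1 - r)" using sum_abs_s_kernel_le[OF r, of "Suc m"] by simp
  finally show ?thesis .
qed (use r in simp)

text \<open>The tail of the \<open>s_kernel\<close> series is geometric, and with its first two
  terms it collapses to a multiple of \<open>1 - z\<close>. Summation by parts supplies the second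
  such factor.\<close>

lemma q_kernel_sums:
  fixes z :: complex
  assumes r: "0 \<le> r" "r < 1" and z: "norm z = 1"
  shows "(\<lambda>j. of_real (q_kernel r j) * z ^ j) sums
    (- (1 - z)\<^sup>2 * (of_real (1 - r) * (1 + z * of_real r) / (1 - z * of_real (r\<^sup>2))))"
proof -
  define R :: complex where "R = of_real r"
  have "norm (z * R\<^sup>2) < 1" using r z by (simp add: R_def norm_mult norm_power power_less_one_iff)
  then have ne: "1 - z * R\<^sup>2 \<noteq> 0" by (metis eq_iff_diff_eq_0 less_irrefl norm_one)
  let ?s = "\<lambda>k. of_real (s_kernel r k) * z ^ k"
  have "(\<lambda>k. (z * R\<^sup>2) ^ k) sums (1 / (1 - z * R\<^sup>2))"
    by (rule geometric_sums) fact
  then have "(\<lambda>k. - (R * (1 - R\<^sup>2)\<^sup>2 * z\<^sup>2) * (z * R\<^sup>2) ^ k) sums (- (R * (1 - R\<^sup>2)\<^sup>2 * z\<^sup>2) * (1 / (1 - z * R\<^sup>2)))"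
    by (rule sums_mult)
  also have "(\<lambda>k. - (R * (1 - R\<^sup>2)\<^sup>2 * z\<^sup>2) * (z * R\<^sup>2) ^ k) = (\<lambda>k. ?s (Suc (Suc k)))"
    unfolding s_kernel_add_2 R_def by (rule ext) (simp add: power_mult_distrib mult_ac power2_eq_square)
  finally have "?s sums (- (R * (1 - R\<^sup>2)\<^sup>2 * z\<^sup>2) * (1 / (1 - z * R\<^sup>2)) + ?s (Suc 0) + ?s 0)"
    by (intro sums_Suc)
  also have "- (R * (1 - R\<^sup>2)\<^sup>2 * z\<^sup>2) * (1 / (1 - z * R\<^sup>2)) + ?s (Suc 0) + ?s 0
     = (1 - z) * ((1 - R) * (1 + z * R) / (1 - z * R\<^sup>2))" (is "?l = ?r")
  proof -
    \<comment> \<open>The denominator is cleared first, leaving a polynomial identity in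
      \<open>R\<close> and \<open>z\<close>.\<close>
    have "(- u * (1 / w) + v + v') * w = - u + (v + v') * w" if "w \<noteq> 0" for u v v' w :: complex
      using that by (simp add: distrib_right left_diff_distrib)
    from this[OF ne]
    have "?l * (1 - z * R\<^sup>2) = - (R * (1 - R\<^sup>2)\<^sup>2 * z\<^sup>2) + (?s (Suc 0) + ?s 0) * (1 - z * R\<^sup>2)" .
    also have "\<dots> = (1 - z) * ((1 - R) * (1 + z * R))"
      by (simp add: R_def) algebra
    finally show ?thesis using ne by (simp add: eq_divide_eq)
  qed
  finally have s: "?s sums ((1 - z) * ((1 - R) * (1 + z * R) / (1 - z * R\<^sup>2)))" .
  \<comment> \<open>The boundary term of the summation by parts vanishes in the limit, being the
    general term of a convergent series.\<close>
  have "(\<lambda>n. (z - 1) * (\<Sum>k<n. ?s k) - ?s n) \<longlonglongrightarrow> (z - 1) * ((1 - z) * ((1 - R) * (1 + z * R) / (1 - z * R\<^sup>2))) - 0"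
    using s summable_LIMSEQ_zero[OF sums_summable[OF s]]
    by (intro tendsto_intros) (auto simp: sums_def)
  then have "(\<lambda>n. \<Sum>j<Suc n. of_real (q_kernel r j) * z ^ j) \<longlonglongrightarrow>
      - (1 - z)\<^sup>2 * ((1 - R) * (1 + z * R) / (1 - z * R\<^sup>2))"
    unfolding sum_q_kernel by (simp add: power2_eq_square algebra_simps)
  then show ?thesis
    unfolding sums_def by (subst (asm) filterlim_sequentially_Suc) (simp add: R_def)
qed

text \<open>\<open>h\<close> is the second factor of the sum in \<open>q_kernel_sums\<close> at
  \<open>r = exp (-a)\<close>, \<open>z = cis \<theta>\<close>. The squared modulus of its
  denominator is \<open>4 * r\<^sup>2 * D\<close>, and \<open>2 * r * sinh a = 1 - r\<^sup>2\<close>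
  and its \<open>cosh\<close> analogue turn powers of \<open>r\<close> into hyperbolic
  functions.\<close>

lemma kernel_symbol_real_imag:
  fixes a \<theta> :: real
  defines "h \<equiv> of_real (1 - exp (-a)) * (1 + cis \<theta> * of_real (exp (-a))) / (1 - cis \<theta> * of_real ((exp (-a))\<^sup>2))"
  assumes "0 < a"
  shows "Re h = ((sinh a)\<^sup>2 + (sin (\<theta>/2))\<^sup>2 - (sin (\<theta>/2))\<^sup>2 * cosh a) / ((sinh a)\<^sup>2 + (sin (\<theta>/2))\<^sup>2)"
    and "Im h = sin (\<theta>/2) * cos (\<theta>/2) * sinh a / ((sinh a)\<^sup>2 + (sin (\<theta>/2))\<^sup>2)"
proof -
  define r c s D where "r = exp (-a)" and "c = cos \<theta>" and "s = sin \<theta>"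
    and "D = (sinh a)\<^sup>2 + (sin (\<theta>/2))\<^sup>2"
  have cs: "c\<^sup>2 + s\<^sup>2 = 1" by (simp add: c_def s_def)
  have r: "0 < r" "r < 1" using assms by (auto simp: r_def)
  have ra: "r * exp a = 1" by (simp add: r_def exp_minus)
  have cosh: "2 * r * cosh a = 1 + r\<^sup>2" and sinh: "2 * r * sinh a = 1 - r\<^sup>2"
  proof -
    have "2 * cosh a = exp a + r" "2 * sinh a = exp a - r"
      by (simp_all add: cosh_def sinh_def r_def)
    with ra show "2 * r * cosh a = 1 + r\<^sup>2" "2 * r * sinh a = 1 - r\<^sup>2" by algebra+
  qed
  have \<sigma>: "2 * (sin (\<theta>/2))\<^sup>2 = 1 - c" and sc: "2 * (sin (\<theta>/2) * cos (\<theta>/2)) = s"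
    using cos_double_sin[of "\<theta>/2"] sin_double[of "\<theta>/2"] by (simp_all add: c_def s_def)
  have D: "4 * r\<^sup>2 * D = (1 - r\<^sup>2)\<^sup>2 + 2 * r\<^sup>2 * (1 - c)"
    unfolding D_def sinh[symmetric] \<sigma>[symmetric] by (simp add: algebra_simps power2_eq_square)
  have "0 < D" using assms by (simp add: D_def add_pos_nonneg)
  have den: "(1 - c * r\<^sup>2)\<^sup>2 + (s * r\<^sup>2)\<^sup>2 = 4 * r\<^sup>2 * D"
    unfolding D using cs by algebra
  have "Re h = (1 - r) * ((1 + c * r) * (1 - c * r\<^sup>2) - (s * r) * (s * r\<^sup>2)) / (4 * r\<^sup>2 * D)"
    unfolding h_def r_def[symmetric] den[symmetric]
    by (simp add: Re_divide c_def s_def power2_eq_square algebra_simps)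
  also have "(1 - r) * ((1 + c * r) * (1 - c * r\<^sup>2) - (s * r) * (s * r\<^sup>2))
      = 4 * r\<^sup>2 * D - r * (1 - c) * (1 + r\<^sup>2)"
    unfolding D using cs by algebra
  also have "\<dots> = 4 * r\<^sup>2 * (D - (sin (\<theta>/2))\<^sup>2 * cosh a)"
    unfolding cosh[symmetric] \<sigma>[symmetric] by (simp add: algebra_simps power2_eq_square)
  finally show "Re h = ((sinh a)\<^sup>2 + (sin (\<theta>/2))\<^sup>2 - (sin (\<theta>/2))\<^sup>2 * cosh a) / ((sinh a)\<^sup>2 + (sin (\<theta>/2))\<^sup>2)"
    using r by (simp flip: D_def)
  have "Im h = (1 - r) * ((s * r) * (1 - c * r\<^sup>2) + (1 + c * r) * (s * r\<^sup>2)) / (4 * r\<^sup>2 * D)"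
    unfolding h_def r_def[symmetric] den[symmetric]
    by (simp add: Im_divide c_def s_def power2_eq_square algebra_simps)
  also have "(1 - r) * ((s * r) * (1 - c * r\<^sup>2) + (1 + c * r) * (s * r\<^sup>2)) = s * r * (1 - r\<^sup>2)"
    by algebra
  also have "\<dots> = 4 * r\<^sup>2 * (sin (\<theta>/2) * cos (\<theta>/2) * sinh a)"
    unfolding sinh[symmetric] sc[symmetric] by (simp add: algebra_simps power2_eq_square)
  finally show "Im h = sin (\<theta>/2) * cos (\<theta>/2) * sinh a / ((sinh a)\<^sup>2 + (sin (\<theta>/2))\<^sup>2)"
    using r by (simp flip: D_def)
qed

subsection \<open>Integral representation of the generating function\<close>

text \<open>For \<open>0 < \<delta> < 1\<close> this is
  \<open>Gamma (1 - \<delta>) / \<delta>\<close>; it enters as a positive normalising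
  factor.\<close>

definition power_const :: "real \<Rightarrow> real" where
  "power_const \<delta> = integral {0<..} (\<lambda>a. (1 - exp (-a)) * a powr (-1-\<delta>))"

text \<open>Combining \<open>1 - exp (-a) \<le> a\<close> for small \<open>a\<close> with
  \<open>1 - exp (-a) \<le> 1\<close> for large \<open>a\<close> bounds the integrand by two
  instances of \<open>has_integral_powr_div_sum_squares\<close>, with exponents
  \<open>- \<delta>\<close> and \<open>1 - \<delta>\<close>.\<close>

lemma absolutely_integrable_one_minus_exp_powr:
  fixes \<delta> :: real
  assumes "0 < \<delta>" "\<delta> < 1"
  shows "(\<lambda>a. (1 - exp (-a)) * a powr (-1-\<delta>)) absolutely_integrable_on {0<..}"
proof (rule measurable_bounded_by_integrable_imp_absolutely_integrable)
  show "(\<lambda>a. (1 - exp (-a)) * a powr (-1-\<delta>)) \<in> borel_measurable (lebesgue_on {0<..})"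
    by (intro continuous_imp_measurable_on_sets_lebesgue continuous_intros) auto
  have "(\<lambda>a. a powr s / (a\<^sup>2 + 1\<^sup>2)) integrable_on {0<..}" if "-1 < s" "s < 1" for s :: real
    using has_integral_powr_div_sum_squares[OF that, of 1] by auto
  then show "(\<lambda>a. a powr (-\<delta>) / (a\<^sup>2 + 1\<^sup>2) + a powr (1-\<delta>) / (a\<^sup>2 + 1\<^sup>2)) integrable_on {0<..}"
    using assms by (intro integrable_add) auto
next
  fix a :: real assume "a \<in> {0<..}"
  then have a: "0 < a" by simp
  have "(1 - exp (-a)) * (a\<^sup>2 + 1) \<le> a * (1 + a)"
  proof (cases "a \<le> 1")
    case True
    have "(1 - exp (-a)) * (a\<^sup>2 + 1) \<le> a * (a\<^sup>2 + 1)"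
      using exp_ge_add_one_self[of "-a"] by (intro mult_right_mono) auto
    also have "\<dots> \<le> a * (1 + a)"
      using a True by (intro mult_left_mono) (auto simp: power2_eq_square mult_left_le)
    finally show ?thesis .
  next
    case False
    have "(1 - exp (-a)) * (a\<^sup>2 + 1) \<le> 1 * (a\<^sup>2 + 1)"
      by (intro mult_right_mono) auto
    also have "\<dots> \<le> a * (1 + a)" using False by (simp add: power2_eq_square algebra_simps)
    finally show ?thesis .
  qed
  moreover have pos: "0 < a\<^sup>2 + 1" by (simp add: add_nonneg_pos)
  ultimately have "1 - exp (-a) \<le> a * (1 + a) / (a\<^sup>2 + 1)" by (simp only: pos_le_divide_eq)
  then have "(1 - exp (-a)) * a powr (-1-\<delta>) \<le> a * (1 + a) / (a\<^sup>2 + 1) * a powr (-1-\<delta>)"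
    by (intro mult_right_mono) auto
  also have "\<dots> = (1 + a) * (a * a powr (-1-\<delta>)) / (a\<^sup>2 + 1)" by simp
  also have "a * a powr (-1-\<delta>) = a powr (-\<delta>)"
    using powr_add[of a 1 "-1-\<delta>"] a by simp
  also have "(1 + a) * a powr (-\<delta>) = a powr (-\<delta>) + a powr (1-\<delta>)"
    using powr_add[of a 1 "-\<delta>"] a by (simp add: distrib_right)
  finally show "norm ((1 - exp (-a)) * a powr (-1-\<delta>))
      \<le> a powr (-\<delta>) / (a\<^sup>2 + 1\<^sup>2) + a powr (1-\<delta>) / (a\<^sup>2 + 1\<^sup>2)"
    using a by (simp add: abs_mult add_divide_distrib)
qed auto

text \<open>Strictness comes from the compact interval from 1 to 2; elsewhere nonnegativity
  suffices.\<close>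

lemma has_integral_halfline_pos:
  fixes f :: "real \<Rightarrow> real"
  assumes f: "(f has_integral i) {0<..}" and cont: "continuous_on {0<..} f"
    and pos: "\<And>x. 0 < x \<Longrightarrow> 0 < f x"
  shows "0 < i"
proof -
  have c: "continuous_on {1..2} f" using cont by (rule continuous_on_subset) auto
  then have "(f has_integral integral {1..2} f) {1..2}"
    by (intro integrable_integral integrable_continuous_real)
  then have "integral {1..2} f \<le> i"
    using f pos by (intro has_integral_subset_le[of "{1..2}" "{0<..}" f]) (auto simp: less_imp_le)
  moreover have "integral {1..2::real} (\<lambda>_. 0::real) < integral {1..2} f"
    by (rule integral_less_real) (use c pos in auto)
  ultimately show ?thesis by simp
qed

lemma power_const_pos:
  assumes "0 < \<delta>" "\<delta> < 1"
  shows "0 < power_const \<delta>"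
proof (rule has_integral_halfline_pos)
  show "((\<lambda>a. (1 - exp (-a)) * a powr (-1-\<delta>)) has_integral power_const \<delta>) {0<..}"
    unfolding power_const_def using absolutely_integrable_one_minus_exp_powr[OF assms]
    by (intro integrable_integral) (rule set_lebesgue_integral_eq_integral)
qed (auto intro!: continuous_intros)

text \<open>Replacing \<open>a\<close> by \<open>x * a\<close> scales the homogeneous weight, which
  leaves the factor \<open>x powr \<delta>\<close>.\<close>

lemma has_integral_power_kernel:
  fixes \<delta> x :: real
  assumes \<delta>: "0 < \<delta>" "\<delta> < 1" and x: "0 < x"
  shows "((\<lambda>a. (1 - exp (- (x * a))) * a powr (-1-\<delta>)) has_integral power_const \<delta> * x powr \<delta>) {0<..}"
proof -
  let ?f = "\<lambda>a. (1 - exp (-a)) * a powr (-1-\<delta>)"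
  have img: "(*) x ` {0<..} = {0<..}"
  proof (intro equalityI subsetI)
    fix a :: real assume "a \<in> {0<..}"
    then have "a = x * (a / x)" "a / x \<in> {0<..}" using x by auto
    then show "a \<in> (*) x ` {0<..}" by blast
  qed (use x in auto)
  have "(\<lambda>a. \<bar>x\<bar> * ?f (x * a)) absolutely_integrable_on {0<..} \<and>
      integral {0<..} (\<lambda>a. \<bar>x\<bar> * ?f (x * a)) = power_const \<delta>"
    using absolutely_integrable_one_minus_exp_powr[OF \<delta>] x
    by (subst has_absolute_integral_change_of_variables_1'[where g = "(*) x"])
       (auto simp: img power_const_def inj_on_def intro!: derivative_eq_intros)
  then have "((\<lambda>a. \<bar>x\<bar> * ?f (x * a)) has_integral power_const \<delta>) {0<..}"
    by (simp add: has_integral_iff set_lebesgue_integral_eq_integral)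
  then have "((\<lambda>a. x powr \<delta> * (\<bar>x\<bar> * ?f (x * a))) has_integral power_const \<delta> * x powr \<delta>) {0<..}"
    by (subst mult.commute[of "power_const \<delta>"]) (rule has_integral_mult_right)
  then show ?thesis
  proof (rule has_integral_eq[rotated])
    fix a assume "a \<in> {0::real<..}"
    then have "x powr \<delta> * (x * ?f (x * a)) = (x powr \<delta> * x powr 1 * x powr (-1-\<delta>)) * ((1 - exp (- (x * a))) * a powr (-1-\<delta>))"
      using x by (simp add: powr_mult)
    also have "x powr \<delta> * x powr 1 * x powr (-1-\<delta>) = 1"
      using x by (simp only: powr_add[symmetric]) simp
    finally show "x powr \<delta> * (\<bar>x\<bar> * ?f (x * a)) = (1 - exp (- (x * a))) * a powr (-1-\<delta>)" using x by simp
  qed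
qed

lemma has_integral_s_q_kernel:
  fixes \<delta> :: real
  assumes \<delta>: "0 < \<delta>" "\<delta> < 1"
  shows has_integral_s_kernel: "((\<lambda>a. s_kernel (exp (-a)) k * a powr (-1-\<delta>)) has_integral
      power_const \<delta> * 2 powr \<delta> * s_coeff \<delta> k) {0<..}"
    and has_integral_q_kernel: "((\<lambda>a. q_kernel (exp (-a)) k * a powr (-1-\<delta>)) has_integral
      power_const \<delta> * 2 powr \<delta> * q_coeff \<delta> k) {0<..}"
proof -
  let ?C = "power_const \<delta> * 2 powr \<delta>"
  \<comment> \<open>Taking \<open>x = 2 * y\<close> turns the half-integers of
    \<open>s_coeff\<close> into integer exponents, at the cost of the factor
    \<open>2 powr \<delta>\<close>.\<close>
  have base: "((\<lambda>a. (1 - exp (-a) ^ m) * a powr (-1-\<delta>)) has_integral ?C * y powr \<delta>) {0<..}"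
    if "real m = 2 * y" "0 < y" for m y
    using has_integral_power_kernel[OF \<delta>, of "2 * y"] that
    by (simp add: powr_mult mult_ac flip: exp_of_nat_mult)
  show s: "((\<lambda>a. s_kernel (exp (-a)) k * a powr (-1-\<delta>)) has_integral ?C * s_coeff \<delta> k) {0<..}" for k
  proof (cases "(\<delta>, k)" rule: s_coeff.cases)
    case 1
    then show ?thesis using base[of 1 "1/2"] by simp
  next
    case 2
    have "((\<lambda>a. (1 - exp (-a) ^ 3) * a powr (-1-\<delta>) - 2 * ((1 - exp (-a) ^ 1) * a powr (-1-\<delta>))) has_integral
        ?C * (3/2) powr \<delta> - 2 * (?C * (1/2) powr \<delta>)) {0<..}"
      by (intro has_integral_diff has_integral_mult_right base) auto
    with 2 show ?thesis by (simp add: algebra_simps)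
  next
    case (3 \<delta>' m)
    have "((\<lambda>a. (1 - exp (-a) ^ (2 * m + 5)) * a powr (-1-\<delta>) - 2 * ((1 - exp (-a) ^ (2 * m + 3)) * a powr (-1-\<delta>))
          + (1 - exp (-a) ^ (2 * m + 1)) * a powr (-1-\<delta>)) has_integral
        ?C * (real k + 1/2) powr \<delta> - 2 * (?C * (real k - 1/2) powr \<delta>) + ?C * (real k - 3/2) powr \<delta>) {0<..}"
      using 3 by (intro has_integral_add has_integral_diff has_integral_mult_right base) auto
    moreover have "k = Suc (Suc m)" using 3 by simp
    ultimately show ?thesis by (simp add: algebra_simps)
  qed
  show "((\<lambda>a. q_kernel (exp (-a)) k * a powr (-1-\<delta>)) has_integral ?C * q_coeff \<delta> k) {0<..}"
  proof (cases k)
    case 0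
    then show ?thesis using has_integral_neg[OF s[of 0]] by (simp add: left_diff_distrib)
  next
    case (Suc m)
    then show ?thesis using has_integral_diff[OF s[of m] s[of "Suc m"]]
      by (simp add: left_diff_distrib right_diff_distrib)
  qed
qed

text \<open>Each partial sum of the series is an integral by \<open>has_integral_q_kernel\<close>.
  The kernel partial sums converge by \<open>q_kernel_sums\<close> and are dominated by
  \<open>norm_sum_q_kernel_le\<close>, so dominated convergence applies.\<close>

lemma has_integral_g_fun:
  fixes \<delta> \<theta> :: real
  assumes \<delta>: "0 < \<delta>" "\<delta> < 1"
  shows "((\<lambda>a. of_real (4 * (sin (\<theta>/2))\<^sup>2 * a powr (-1-\<delta>)) *
      (of_real (1 - exp (-a)) * (1 + cis \<theta> * of_real (exp (-a))) / (1 - cis \<theta> * of_real ((exp (-a))\<^sup>2))))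
      has_integral of_real (power_const \<delta> * 2 powr \<delta>) * g_fun \<delta> \<theta>) {0<..}"
proof -
  define C where "C = power_const \<delta> * 2 powr \<delta>"
  define z where "z = cis \<theta>"
  define h where "h = (\<lambda>a. of_real (1 - exp (-a)) * (1 + z * of_real (exp (-a))) / (1 - z * of_real ((exp (-a))\<^sup>2)))"
  define f where "f = (\<lambda>n a. inverse z * (\<Sum>j<n. of_real (q_kernel (exp (-a)) j) * z ^ j) * of_real (a powr (-1-\<delta>)))"
  have z: "norm z = 1" "z \<noteq> 0" by (simp_all add: z_def)
  have zpow: "exp (\<i> * complex_of_real ((real j - 1) * \<theta>)) = inverse z * z ^ j" for j
    by (simp add: z_def cis_conv_exp exp_minus[symmetric] exp_of_nat_mult[symmetric] exp_add[symmetric] algebra_simps)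
  \<comment> \<open>The factor \<open>inverse z\<close> stems from the exponent starting at -1. It
    makes the double zero at \<open>z = 1\<close> a nonnegative real factor.\<close>
  have sq: "- (inverse z * (1 - z)\<^sup>2) = of_real (4 * (sin (\<theta>/2))\<^sup>2)"
  proof -
    have "- (inverse z * (1 - z)\<^sup>2) = 2 - z - inverse z"
      using z by (simp add: power2_eq_square algebra_simps)
    also have "\<dots> = of_real (2 - 2 * cos \<theta>)" by (simp add: z_def complex_eq_iff)
    also have "2 - 2 * cos \<theta> = 4 * (sin (\<theta>/2))\<^sup>2" using cos_double_sin[of "\<theta>/2"] by simp
    finally show ?thesis .
  qed
  have f_int: "(f n has_integral (\<Sum>j<n. of_real C * (of_real (q_coeff \<delta> j) * exp (\<i> * complex_of_real ((real j - 1) * \<theta>))))) {0<..}" for n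
  proof -
    have "((\<lambda>a. (inverse z * z ^ j) * of_real (q_kernel (exp (-a)) j * a powr (-1-\<delta>))) has_integral
        (inverse z * z ^ j) * of_real (C * q_coeff \<delta> j)) {0<..}" for j
      using has_integral_q_kernel[OF \<delta>, of j] unfolding C_def
      by (intro has_integral_mult_right has_integral_of_real)
    then have "((\<lambda>a. \<Sum>j<n. (inverse z * z ^ j) * of_real (q_kernel (exp (-a)) j * a powr (-1-\<delta>))) has_integral
        (\<Sum>j<n. (inverse z * z ^ j) * of_real (C * q_coeff \<delta> j))) {0<..}"
      by (intro has_integral_sum) auto
    then show ?thesis unfolding f_def zpow
      by (simp add: sum_distrib_left sum_distrib_right mult_ac)
  qed
  have lim: "(\<lambda>n. f n a) \<longlonglongrightarrow> of_real (4 * (sin (\<theta>/2))\<^sup>2 * a powr (-1-\<delta>)) * h a" if "a \<in> {0<..}" for a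
  proof -
    have "(\<lambda>n. \<Sum>j<n. of_real (q_kernel (exp (-a)) j) * z ^ j) \<longlonglongrightarrow> - (1 - z)\<^sup>2 * h a"
      using q_kernel_sums[of "exp (-a)" z] that z unfolding h_def sums_def by simp
    then have "(\<lambda>n. f n a) \<longlonglongrightarrow> inverse z * (- (1 - z)\<^sup>2 * h a) * of_real (a powr (-1-\<delta>))"
      unfolding f_def by (intro tendsto_intros)
    also have "inverse z * (- (1 - z)\<^sup>2 * h a) * of_real (a powr (-1-\<delta>))
        = - (inverse z * (1 - z)\<^sup>2) * of_real (a powr (-1-\<delta>)) * h a" by simp
    finally show ?thesis unfolding sq by simp
  qed
  let ?D = "\<lambda>a. 16 * ((1 - exp (-a)) * a powr (-1-\<delta>))"
  have D: "?D integrable_on {0<..}"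
    using absolutely_integrable_one_minus_exp_powr[OF \<delta>]
    by (intro integrable_on_mult_right) (rule set_lebesgue_integral_eq_integral)
  have bound: "norm (f n a) \<le> ?D a" if "a \<in> {0<..}" for n a
  proof -
    have "norm (f n a) = norm (\<Sum>j<n. of_real (q_kernel (exp (-a)) j) * z ^ j) * a powr (-1-\<delta>)"
      by (simp add: f_def norm_mult norm_inverse z)
    also have "\<dots> \<le> 16 * (1 - exp (-a)) * a powr (-1-\<delta>)"
      using norm_sum_q_kernel_le[of "exp (-a)" z n] that z by (intro mult_right_mono) auto
    finally show ?thesis by (simp only: mult.assoc)
  qed
  note dc = dominated_convergence[of f "{0<..}", OF _ D bound lim]
  let ?F = "\<lambda>a. of_real (4 * (sin (\<theta>/2))\<^sup>2 * a powr (-1-\<delta>)) * h a"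
  have F: "?F integrable_on {0<..}" and
    conv: "(\<lambda>n. integral {0<..} (f n)) \<longlonglongrightarrow> integral {0<..} ?F"
    using dc f_int by (blast)+
  have "C \<noteq> 0" using power_const_pos[OF \<delta>] by (simp add: C_def)
  moreover have "integral {0<..} (f n) = of_real C * (\<Sum>j<n. of_real (q_coeff \<delta> j) * exp (\<i> * complex_of_real ((real j - 1) * \<theta>)))" for n
    using f_int[of n] by (simp add: sum_distrib_left integral_unique)
  ultimately have "(\<lambda>n. \<Sum>j<n. of_real (q_coeff \<delta> j) * exp (\<i> * complex_of_real ((real j - 1) * \<theta>)))
      \<longlonglongrightarrow> integral {0<..} ?F / of_real C"
    using tendsto_divide[OF conv tendsto_const[of "of_real C"]] by simp
  \<comment> \<open>The limit above also proves convergence of the series, so \<open>suminf\<close>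
    denotes its actual sum.\<close>
  then have "g_fun \<delta> \<theta> = integral {0<..} ?F / of_real C"
    unfolding g_fun_def by (intro sums_unique[symmetric]) (simp add: sums_def)
  with F \<open>C \<noteq> 0\<close> have "(?F has_integral of_real C * g_fun \<delta> \<theta>) {0<..}"
    by (simp add: has_integral_integral)
  then show ?thesis unfolding h_def C_def z_def .
qed

section \<open>The sector estimate for the generating function\<close>

text \<open>The choices \<open>\<epsilon> = 1\<close> and \<open>\<epsilon> = -1\<close> give the
  two boundary rays of the sector of half-angle \<open>\<delta> / 2 * pi\<close>, so both parts of
  the theorem follow from this one inequality.\<close>

lemma g_fun_sector:
  fixes \<delta> \<theta> \<epsilon> :: real
  assumes \<delta>: "0 < \<delta>" "\<delta> < 1" and \<theta>: "sin (\<theta>/2) \<noteq> 0" and \<epsilon>: "\<bar>\<epsilon>\<bar> = 1"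
  shows "0 < sin (\<delta> / 2 * pi) * Re (g_fun \<delta> \<theta>) + \<epsilon> * cos (\<delta> / 2 * pi) * Im (g_fun \<delta> \<theta>)"
proof -
  define S K \<sigma> \<beta> \<tau> where "S = sin (\<delta> / 2 * pi)" and "K = cos (\<delta> / 2 * pi)"
    and "\<sigma> = sin (\<theta>/2)" and "\<beta> = arcsin \<bar>\<sigma>\<bar>" and "\<tau> = \<bar>\<sigma>\<bar> / \<beta>"
  have S: "0 < S" and K: "0 < K"
    unfolding S_def K_def using \<delta> mult_strict_right_mono[of \<delta> 1 pi]
    by (auto intro!: sin_gt_zero cos_gt_zero)
  have \<sigma>: "0 < \<bar>\<sigma>\<bar>" "\<bar>\<sigma>\<bar> \<le> 1" using \<theta> by (auto simp: \<sigma>_def)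
  have \<beta>: "0 < \<beta>" "\<beta> \<le> pi/2" "sin \<beta> = \<bar>\<sigma>\<bar>"
    using \<sigma> arcsin_less_arcsin[of 0 "\<bar>\<sigma>\<bar>"] arcsin_bounded[of "\<bar>\<sigma>\<bar>"] by (auto simp: \<beta>_def)
  have cos\<beta>: "cos \<beta> = \<bar>cos (\<theta>/2)\<bar>"
    unfolding \<beta>_def using \<sigma> by (subst cos_arcsin) (auto simp: \<sigma>_def cos_squared_eq[symmetric])
  define D where "D = (\<lambda>a. (sinh a)\<^sup>2 + \<sigma>\<^sup>2)"
  have D: "0 < D a" for a using \<sigma> by (simp add: D_def add_nonneg_pos)
  define X where "X = (\<lambda>a. ((sinh a)\<^sup>2 + \<sigma>\<^sup>2 - \<sigma>\<^sup>2 * cosh a) / D a)"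
  define Y where "Y = (\<lambda>a. \<sigma> * cos (\<theta>/2) * sinh a / D a)"
  define C where "C = power_const \<delta> * 2 powr \<delta>"
  define w where "w = (\<lambda>a. 4 * \<sigma>\<^sup>2 * a powr (-1-\<delta>))"
  define P where "P = (\<lambda>a. (S * a - K * \<beta>) * a powr (-\<delta>) / (a\<^sup>2 + \<beta>\<^sup>2))"
  define h where "h = (\<lambda>a. of_real (1 - exp (-a)) * (1 + cis \<theta> * of_real (exp (-a)))
      / (1 - cis \<theta> * of_real ((exp (-a))\<^sup>2)))"
  have h: "Re (h a) = X a" "Im (h a) = Y a" if "0 < a" for a
    using kernel_symbol_real_imag[OF that, of \<theta>] by (simp_all only: h_def X_def Y_def D_def \<sigma>_def)
  have g: "((\<lambda>a. of_real (w a) * h a) has_integral of_real C * g_fun \<delta> \<theta>) {0<..}"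
    using has_integral_g_fun[OF \<delta>, of \<theta>] by (simp only: w_def h_def C_def \<sigma>_def)
  have "((\<lambda>a. w a * Re (h a)) has_integral C * Re (g_fun \<delta> \<theta>)) {0<..}"
    using has_integral_linear[OF g bounded_linear_Re] by (simp add: o_def)
  then have "((\<lambda>a. w a * X a) has_integral C * Re (g_fun \<delta> \<theta>)) {0<..}"
    by (rule has_integral_eq[rotated]) (simp add: h)
  moreover have "((\<lambda>a. w a * Im (h a)) has_integral C * Im (g_fun \<delta> \<theta>)) {0<..}"
    using has_integral_linear[OF g bounded_linear_Im] by (simp add: o_def)
  then have "((\<lambda>a. w a * Y a) has_integral C * Im (g_fun \<delta> \<theta>)) {0<..}"
    by (rule has_integral_eq[rotated]) (simp add: h)
  moreover have "(P has_integral 0) {0<..}"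
    unfolding P_def S_def K_def using \<delta> \<beta> by (intro has_integral_pole_balance) auto
  \<comment> \<open>Subtracting a multiple of \<open>P\<close>, whose integral is 0, preserves the
    value and makes the integrand positive at every point.\<close>
  ultimately have "((\<lambda>a. S * (w a * X a) + \<epsilon> * K * (w a * Y a) - 4 * \<sigma>\<^sup>2 * \<tau> * P a) has_integral
      S * (C * Re (g_fun \<delta> \<theta>)) + \<epsilon> * K * (C * Im (g_fun \<delta> \<theta>)) - 4 * \<sigma>\<^sup>2 * \<tau> * 0) {0<..}"
    by (intro has_integral_diff has_integral_add has_integral_mult_right)
  moreover have "continuous_on {0<..} (\<lambda>a. S * (w a * X a) + \<epsilon> * K * (w a * Y a) - 4 * \<sigma>\<^sup>2 * \<tau> * P a)"
    unfolding w_def X_def Y_def P_def using D \<beta>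
    by (intro continuous_intros) (auto simp: D_def less_imp_neq[symmetric] add_nonneg_pos intro!: continuous_intros)
  moreover have "0 < S * (w a * X a) + \<epsilon> * K * (w a * Y a) - 4 * \<sigma>\<^sup>2 * \<tau> * P a" if a: "0 < a" for a
  proof -
    have pos: "0 < a\<^sup>2 + \<beta>\<^sup>2" using a by (simp add: add_pos_nonneg)
    have X: "\<tau> * a\<^sup>2 / (a\<^sup>2 + \<beta>\<^sup>2) < X a"
      using sinh_sin_real_bound[OF a \<beta>(1,2)] \<beta> pos D[of a]
      by (simp add: \<beta>(3) X_def \<tau>_def D_def divide_simps mult_ac)
    have "\<bar>Y a\<bar> = \<bar>\<sigma>\<bar> * (sinh a * cos \<beta> / D a)"
      using a D[of a] by (simp add: Y_def cos\<beta> abs_mult abs_divide)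
    also have "sinh a * cos \<beta> / D a \<le> a / (a\<^sup>2 + \<beta>\<^sup>2)"
      using sinh_sin_imag_bound[OF a \<beta>(1,2)] pos D[of a]
      by (simp add: \<beta>(3) D_def divide_simps mult_ac)
    finally have Y: "\<bar>Y a\<bar> \<le> \<tau> * \<beta> * a / (a\<^sup>2 + \<beta>\<^sup>2)"
      using \<beta> by (simp add: \<tau>_def mult_left_mono)
    have "\<bar>\<epsilon> * Y a\<bar> = \<bar>Y a\<bar>" using \<epsilon> by (simp add: abs_mult)
    with Y have "- (\<tau> * \<beta> * a / (a\<^sup>2 + \<beta>\<^sup>2)) \<le> \<epsilon> * Y a" by linarith
    \<comment> \<open>The resulting lower bound changes sign at \<open>a = K * \<beta> / S\<close>,
      so it does not give positivity by itself. Multiplied by \<open>w a\<close> it is exactly the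
      subtracted multiple of \<open>P\<close>.\<close>
    with X have "S * (\<tau> * a\<^sup>2 / (a\<^sup>2 + \<beta>\<^sup>2)) + K * - (\<tau> * \<beta> * a / (a\<^sup>2 + \<beta>\<^sup>2)) < S * X a + K * (\<epsilon> * Y a)"
      using S K by (intro add_less_le_mono mult_strict_left_mono mult_left_mono) auto
    also have "S * (\<tau> * a\<^sup>2 / (a\<^sup>2 + \<beta>\<^sup>2)) + K * - (\<tau> * \<beta> * a / (a\<^sup>2 + \<beta>\<^sup>2))
        = \<tau> * a * (S * a - K * \<beta>) / (a\<^sup>2 + \<beta>\<^sup>2)"
      by (simp add: power2_eq_square algebra_simps diff_divide_distrib)
    finally have less: "w a * (\<tau> * a * (S * a - K * \<beta>) / (a\<^sup>2 + \<beta>\<^sup>2)) < w a * (S * X a + K * (\<epsilon> * Y a))"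
      using a \<sigma> by (intro mult_strict_left_mono) (auto simp: w_def)
    have powr: "a * a powr (-1-\<delta>) = a powr (-\<delta>)"
      using powr_add[of a 1 "-1-\<delta>"] a by simp
    have "w a * (\<tau> * a * (S * a - K * \<beta>) / (a\<^sup>2 + \<beta>\<^sup>2))
        = 4 * \<sigma>\<^sup>2 * \<tau> * ((S * a - K * \<beta>) * (a * a powr (-1-\<delta>)) / (a\<^sup>2 + \<beta>\<^sup>2))"
      by (simp add: w_def mult_ac)
    also have "\<dots> = 4 * \<sigma>\<^sup>2 * \<tau> * P a" by (simp only: P_def powr)
    finally have "4 * \<sigma>\<^sup>2 * \<tau> * P a < w a * (S * X a + K * (\<epsilon> * Y a))" using less by simp
    then show ?thesis by (simp add: distrib_left mult_ac)
  qed
  ultimately have "0 < S * (C * Re (g_fun \<delta> \<theta>)) + \<epsilon> * K * (C * Im (g_fun \<delta> \<theta>)) - 4 * \<sigma>\<^sup>2 * \<tau> * 0"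
    by (rule has_integral_halfline_pos)
  also have "\<dots> = C * (S * Re (g_fun \<delta> \<theta>) + \<epsilon> * K * Im (g_fun \<delta> \<theta>))" by (simp add: algebra_simps)
  finally show ?thesis
    unfolding S_def K_def by (rule zero_less_mult_pos) (simp add: C_def power_const_pos[OF \<delta>])
qed

theorem lemma3p8:
  fixes \<delta> :: real
  assumes "\<delta> \<in> {0<..<1}"
  shows "\<forall>\<theta> \<in> (UNIV :: real set) - {2 * real_of_int k * pi | k :: int. True}.
           Re (g_fun \<delta> \<theta>) > 0 \<and>
           \<bar>Im (g_fun \<delta> \<theta>)\<bar> / Re (g_fun \<delta> \<theta>) < tan (\<delta> / 2 * pi)"
proof
  fix \<theta> assume \<theta>: "\<theta> \<in> (UNIV :: real set) - {2 * real_of_int k * pi | k :: int. True}"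
  have "sin (\<theta>/2) \<noteq> 0"
  proof
    assume "sin (\<theta>/2) = 0"
    then obtain k :: int where "\<theta>/2 = of_int k * pi" unfolding sin_zero_iff_int2 by blast
    then have "\<theta> = 2 * of_int k * pi" by simp
    with \<theta> show False by blast
  qed
  moreover have \<delta>: "0 < \<delta>" "\<delta> < 1" using assms by auto
  ultimately have *: "0 < sin (\<delta> / 2 * pi) * Re (g_fun \<delta> \<theta>) + \<epsilon> * cos (\<delta> / 2 * pi) * Im (g_fun \<delta> \<theta>)"
    if "\<bar>\<epsilon>\<bar> = 1" for \<epsilon>
    using that g_fun_sector by blast
  have pos: "0 < sin (\<delta> / 2 * pi)" "0 < cos (\<delta> / 2 * pi)"
    using \<delta> mult_strict_right_mono[of \<delta> 1 pi] by (auto intro!: sin_gt_zero cos_gt_zero)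
  \<comment> \<open>The two signs of \<open>\<epsilon>\<close> combine to the absolute value.
    Positivity of the real part then follows because the left side is nonnegative.\<close>
  have less: "cos (\<delta> / 2 * pi) * \<bar>Im (g_fun \<delta> \<theta>)\<bar> < sin (\<delta> / 2 * pi) * Re (g_fun \<delta> \<theta>)"
    using *[of 1] *[of "-1"] by (cases "0 \<le> Im (g_fun \<delta> \<theta>)") auto
  moreover have "0 \<le> cos (\<delta> / 2 * pi) * \<bar>Im (g_fun \<delta> \<theta>)\<bar>" using pos by simp
  ultimately have "0 < sin (\<delta> / 2 * pi) * Re (g_fun \<delta> \<theta>)" by linarith
  then have "0 < Re (g_fun \<delta> \<theta>)" using pos by (simp add: zero_less_mult_iff)
  moreover from this less pos have "\<bar>Im (g_fun \<delta> \<theta>)\<bar> / Re (g_fun \<delta> \<theta>) < tan (\<delta> / 2 * pi)"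
    by (simp add: tan_def divide_simps mult_ac)
  ultimately show "Re (g_fun \<delta> \<theta>) > 0 \<and> \<bar>Im (g_fun \<delta> \<theta>)\<bar> / Re (g_fun \<delta> \<theta>) < tan (\<delta> / 2 * pi)" by blast
qed

end
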